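(* There is a constant $C$ such that every 3-program $P$ with $n$ atoms has at most $C\times 1.70711^n$ stable models.
   Context: A clause is $p\leftarrow B$ or $\leftarrow B$ (a constraint), where $p$ is an atom and $B$ is a finite set of literals (atoms $a$ or negated atoms $\mathrm{not}(a)$). A propositional logic program is a finite set of clauses; it is a 3-program if every clause has at most 3 literals, counting the head. $M\subseteq\mathit{At}(P)$ is a stable model of $P$ if $M$ satisfies all constraints of $P$ and is the least model of the Gelfond–Lifschitz reduct $P^M$, obtained by deleting every non-constraint clause with some $\mathrm{not}(a)$, $a\in M$, in its body and deleting negated literals from the remaining non-constraint clauses. *)

theory Defs
  imports Complex_Main
begin

datatype 'a literal = Pos 'a | Neg 'a

datatype 'a clause =
    Rule 'a "'a literal set"
  | Constraint "'a literal set"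

type_synonym 'a program = "'a clause set"

fun atom_of :: "'a literal \<Rightarrow> 'a" where
  "atom_of (Pos a) = a"
| "atom_of (Neg a) = a"

fun body :: "'a clause \<Rightarrow> 'a literal set" where
  "body (Rule p B) = B"
| "body (Constraint B) = B"

fun clause_atoms :: "'a clause \<Rightarrow> 'a set" where
  "clause_atoms (Rule p B) = insert p (atom_of ` B)"
| "clause_atoms (Constraint B) = atom_of ` B"

definition At :: "'a program \<Rightarrow> 'a set" where
  "At P = (\<Union>c\<in>P. clause_atoms c)"

text \<open>The head counts as one literal occurrence of its own, whether or not its
  atom also occurs in the body.\<close>

fun num_literals :: "'a clause \<Rightarrow> nat" where
  "num_literals (Rule p B) = Suc (card B)"
| "num_literals (Constraint B) = card B"

definition logic_program :: "'a program \<Rightarrow> bool" where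
  "logic_program P \<longleftrightarrow> finite P \<and> (\<forall>c\<in>P. finite (body c))"

definition t_program :: "nat \<Rightarrow> 'a program \<Rightarrow> bool" where
  "t_program t P \<longleftrightarrow> logic_program P \<and> (\<forall>c\<in>P. num_literals c \<le> t)"

fun sat_literal :: "'a set \<Rightarrow> 'a literal \<Rightarrow> bool" where
  "sat_literal M (Pos a) \<longleftrightarrow> a \<in> M"
| "sat_literal M (Neg a) \<longleftrightarrow> a \<notin> M"

fun sat_clause :: "'a set \<Rightarrow> 'a clause \<Rightarrow> bool" where
  "sat_clause M (Rule p B) \<longleftrightarrow> ((\<forall>l\<in>B. sat_literal M l) \<longrightarrow> p \<in> M)"
| "sat_clause M (Constraint B) \<longleftrightarrow> \<not> (\<forall>l\<in>B. sat_literal M l)"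

definition model :: "'a program \<Rightarrow> 'a set \<Rightarrow> bool" where
  "model P M \<longleftrightarrow> (\<forall>c\<in>P. sat_clause M c)"

definition least_model :: "'a program \<Rightarrow> 'a set \<Rightarrow> bool" where
  "least_model P M \<longleftrightarrow> model P M \<and> (\<forall>N. model P N \<longrightarrow> M \<subseteq> N)"

text \<open>The Gelfond--Lifschitz reduct is built from the non-constraint clauses only,
  so it is a definite program; constraints merely filter its least models in the
  definition of stable models. Keeping them in the reduct would wrongly
  let them support atoms.\<close>

definition reduct :: "'a program \<Rightarrow> 'a set \<Rightarrow> 'a program" where
  "reduct P M =
     {Rule p {l \<in> B. \<exists>a. l = Pos a} | p B. Rule p B \<in> P \<and> (\<forall>a\<in>M. Neg a \<notin> B)}"

definition stable_model :: "'a program \<Rightarrow> 'a set \<Rightarrow> bool" where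
  "stable_model P M \<longleftrightarrow>
     M \<subseteq> At P \<and>
     (\<forall>B. Constraint B \<in> P \<longrightarrow> sat_clause M (Constraint B)) \<and>
     least_model (reduct P M) M"

text \<open>Finiteness shows that \<^const>\<open>card\<close> counts the stable models properly.\<close>

lemma finite_At:
  assumes "logic_program P"
  shows "finite (At P)"
proof -
  have "finite (clause_atoms c)" if "c \<in> P" for c
    using assms that by (cases c) (force simp: logic_program_def)+
  then show ?thesis
    using assms by (simp add: At_def logic_program_def)
qed

lemma finite_stable_models:
  assumes "logic_program P"
  shows "finite {M. stable_model P M}"
proof (rule finite_subset)
  show "{M. stable_model P M} \<subseteq> Pow (At P)"
    by (auto simp: stable_model_def)
  show "finite (Pow (At P))"
    using finite_At[OF assms] by simp
qed

end

theory Submission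
  imports Defs
begin

text \<open>
  Read every rule and constraint as a clause over literals. An atom \<open>a\<close> of a stable model \<open>M\<close> is
  critical in some clause: \<open>a\<close> is the only literal of it that \<open>M\<close> makes true. For families of models
  with this property we bound the size by \<open>\<rho>\<^sup>n\<close>, where \<open>\<rho> = 1.70711\<close>, by branching on partial
  assignments; fixing \<open>j\<close> literals has weight \<open>\<zeta>\<^sup>j\<close> with \<open>\<zeta> = 1 / \<rho>\<close>. A two-literal clause
  saves the factor \<open>\<tau> = \<zeta> + \<zeta>\<^sup>2\<close>, and up to five of them save the corresponding power of \<open>\<tau>\<close>,
  whether or not they overlap.

  Suppose that all clauses have three literals and let \<open>d\<close> be the number of clauses in which \<open>a\<close>
  occurs positively. Making \<open>a\<close> false leaves \<open>d\<close> two-literal clauses, while making \<open>a\<close> true lets us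
  guess the critical clause, which fixes two more literals in each of \<open>d\<close> ways. The second fact
  settles \<open>d \<le> 2\<close>, the first one \<open>d \<ge> 5\<close>. For \<open>d \<in> {3, 4}\<close> an additional gain comes from two
  clauses at \<open>a\<close> that share another atom, or from a negative occurrence. If there is neither, all
  literals are positive and the clauses at an atom are otherwise disjoint; then each guess of a
  critical clause makes two atoms false and thereby leaves at least \<open>2 (d - 1)\<close> two-literal clauses.
\<close>

section \<open>Literals and supported families of models\<close>

fun neg :: "'a literal \<Rightarrow> 'a literal" where
  "neg (Pos a) = Neg a"
| "neg (Neg a) = Pos a"

lemma neg_neg [simp]: "neg (neg l) = l"
  by (cases l) auto

lemma atom_of_neg [simp]: "atom_of (neg l) = atom_of l"
  by (cases l) auto

lemma sat_literal_neg [simp]: "sat_literal M (neg l) \<longleftrightarrow> \<not> sat_literal M l"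
  by (cases l) auto

lemma neg_eq_iff [simp]: "neg l = neg l' \<longleftrightarrow> l = l'"
  by (metis neg_neg)

lemma neg_neq [simp]: "neg l \<noteq> l" "l \<noteq> neg l"
  by (cases l; simp)+

lemma atom_of_eq_iff: "atom_of l = atom_of l' \<longleftrightarrow> l = l' \<or> l = neg l'"
  by (cases l; cases l') auto

lemma sat_literal_atom: "sat_literal M l \<Longrightarrow> sat_literal M' l \<Longrightarrow> atom_of l \<in> M \<longleftrightarrow> atom_of l \<in> M'"
  by (cases l) auto

text \<open>Members keep the atoms outside \<open>V\<close> that earlier branching has fixed; by
  injectivity, counting members amounts to counting their traces on \<open>V\<close>.\<close>

definition supported_family :: "'a set \<Rightarrow> 'a literal set set \<Rightarrow> 'a set set \<Rightarrow> bool" where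
  "supported_family V F \<M> \<longleftrightarrow>
     finite V \<and> inj_on (\<lambda>M. M \<inter> V) \<M> \<and>
     (\<forall>C\<in>F. finite C \<and> card C \<le> 3 \<and> atom_of ` C \<subseteq> V \<and> (\<forall>l\<in>C. neg l \<notin> C)) \<and>
     (\<forall>M\<in>\<M>. (\<forall>C\<in>F. \<exists>l\<in>C. sat_literal M l) \<and>
       (\<forall>a\<in>M \<inter> V. \<exists>C\<in>F. Pos a \<in> C \<and> (\<forall>l\<in>C - {Pos a}. \<not> sat_literal M l)))"

definition agreeing :: "'a set set \<Rightarrow> 'a literal set \<Rightarrow> 'a set set" where
  "agreeing \<M> L = {M \<in> \<M>. \<forall>l\<in>L. sat_literal M l}"

text \<open>The usual simplification under a partial assignment. Being an image it may identify
  clauses, so \<open>leaf_weight_aux\<close> asks for injectivity.\<close>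

definition residual :: "'a literal set set \<Rightarrow> 'a literal set \<Rightarrow> 'a literal set set" where
  "residual F L = (\<lambda>C. C - neg ` L) ` {C \<in> F. C \<inter> L = {}}"

lemma supported_family_finite:
  assumes "supported_family V F \<M>"
  shows "finite V" "finite \<M>" "finite F"
proof -
  show V: "finite V" using assms by (simp add: supported_family_def)
  have "(\<lambda>M. M \<inter> V) ` \<M> \<subseteq> Pow V" by auto
  then show "finite \<M>"
    using V assms unfolding supported_family_def by (meson finite_Pow_iff finite_imageD finite_subset)
  have "F \<subseteq> Pow (Pos ` V \<union> Neg ` V)"
  proof
    fix C assume "C \<in> F"
    then have C: "atom_of ` C \<subseteq> V" using assms by (simp add: supported_family_def)
    have "l \<in> Pos ` V \<union> Neg ` V" if "l \<in> C" for l
      using C that by (cases l) (force)+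
    then show "C \<in> Pow (Pos ` V \<union> Neg ` V)" by blast
  qed
  then show "finite F" using V by (meson finite_Pow_iff finite_Un finite_imageI finite_subset)
qed

lemma supported_familyD:
  assumes "supported_family V F \<M>"
  shows "C \<in> F \<Longrightarrow> finite C" "C \<in> F \<Longrightarrow> card C \<le> 3" "C \<in> F \<Longrightarrow> atom_of ` C \<subseteq> V"
    "C \<in> F \<Longrightarrow> l \<in> C \<Longrightarrow> atom_of l \<in> V" "C \<in> F \<Longrightarrow> l \<in> C \<Longrightarrow> neg l \<notin> C"
    "M \<in> \<M> \<Longrightarrow> C \<in> F \<Longrightarrow> \<exists>l\<in>C. sat_literal M l"
    "M \<in> \<M> \<Longrightarrow> a \<in> M \<Longrightarrow> a \<in> V \<Longrightarrow> \<exists>C\<in>F. Pos a \<in> C \<and> (\<forall>l\<in>C - {Pos a}. \<not> sat_literal M l)"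
  using assms unfolding supported_family_def by (blast)+

text \<open>A critical clause of an unfixed atom has no other true literal. Hence \<open>L\<close>
  cannot satisfy it: it may be shortened but is never deleted.\<close>

lemma supported_family_residual:
  assumes fam: "supported_family V F \<M>"
  shows "supported_family (V - atom_of ` L) (residual F L) (agreeing \<M> L)"
  unfolding supported_family_def
proof (intro conjI ballI)
  show "finite (V - atom_of ` L)" using supported_family_finite[OF fam] by simp
  show "inj_on (\<lambda>M. M \<inter> (V - atom_of ` L)) (agreeing \<M> L)"
  proof (rule inj_onI)
    fix M M' assume M: "M \<in> agreeing \<M> L" "M' \<in> agreeing \<M> L"
      and eq: "M \<inter> (V - atom_of ` L) = M' \<inter> (V - atom_of ` L)"
    \<comment> \<open>Agreeing members coincide on the atoms of \<open>L\<close>, so dropping these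
      atoms from \<open>V\<close> identifies no members.\<close>
    have "v \<in> M \<longleftrightarrow> v \<in> M'" if v: "v \<in> atom_of ` L" for v
    proof -
      obtain l where "l \<in> L" "v = atom_of l" using v by blast
      then show ?thesis using M sat_literal_atom[of M l M'] by (simp add: agreeing_def)
    qed
    then have "M \<inter> V = M' \<inter> V" using eq by blast
    moreover have "inj_on (\<lambda>M. M \<inter> V) \<M>" using fam by (simp add: supported_family_def)
    ultimately show "M = M'" using M by (simp add: agreeing_def inj_on_def)
  qed
next
  fix D assume "D \<in> residual F L"
  then obtain C where C: "C \<in> F" "C \<inter> L = {}" "D = C - neg ` L" by (auto simp: residual_def)
  show "finite D" using C supported_familyD(1)[OF fam] by simp
  show "card D \<le> 3"
    using C supported_familyD(1,2)[OF fam] by (meson Diff_subset card_mono order_trans)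
  show "atom_of ` D \<subseteq> V - atom_of ` L"
  proof
    fix v assume "v \<in> atom_of ` D"
    then obtain l where l: "l \<in> D" "v = atom_of l" by blast
    have "v \<notin> atom_of ` L"
    proof
      assume "v \<in> atom_of ` L"
      then obtain m where "m \<in> L" "atom_of l = atom_of m" using l by auto
      then show False using l C by (auto simp: atom_of_eq_iff)
    qed
    then show "v \<in> V - atom_of ` L" using l C supported_familyD(4)[OF fam] by blast
  qed
  fix l assume "l \<in> D"
  then show "neg l \<notin> D" using C supported_familyD(5)[OF fam] by blast
next
  fix M D assume M: "M \<in> agreeing \<M> L" and "D \<in> residual F L"
  then obtain C where C: "C \<in> F" "C \<inter> L = {}" "D = C - neg ` L" by (auto simp: residual_def)
  have "M \<in> \<M>" using M by (simp add: agreeing_def)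
  then obtain l where l: "l \<in> C" "sat_literal M l" using C supported_familyD(6)[OF fam] by blast
  then have "l \<notin> neg ` L" using M by (auto simp: agreeing_def)
  then show "\<exists>l\<in>D. sat_literal M l" using l C by blast
next
  fix M a assume M: "M \<in> agreeing \<M> L" and a: "a \<in> M \<inter> (V - atom_of ` L)"
  have "M \<in> \<M>" using M by (simp add: agreeing_def)
  then obtain C where C: "C \<in> F" "Pos a \<in> C" "\<forall>l\<in>C - {Pos a}. \<not> sat_literal M l"
    using a supported_familyD(7)[OF fam] by blast
  have "a \<notin> atom_of ` L" using a by blast
  then have nL: "Pos a \<notin> L" "Pos a \<notin> neg ` L"
    by (metis atom_of.simps(1) atom_of_neg image_iff)+
  have "C \<inter> L = {}" using C M nL unfolding agreeing_def by blast
  then have "C - neg ` L \<in> residual F L" using C by (auto simp: residual_def)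
  then show "\<exists>C\<in>residual F L. Pos a \<in> C \<and> (\<forall>l\<in>C - {Pos a}. \<not> sat_literal M l)"
    using C nL by blast
qed

section \<open>Branching weights\<close>

definition rho :: real where "rho = 1.70711"
definition zeta :: real where "zeta = 1 / rho"
definition tau :: real where "tau = zeta + zeta\<^sup>2"

lemma rho_pos: "rho > 0" by (simp add: rho_def)
lemma zeta_pos: "0 < zeta" and zeta_less_1: "zeta < 1" by (simp_all add: zeta_def rho_def)
lemma tau_pos: "0 < tau" and tau_less_1: "tau < 1" by (simp_all add: tau_def zeta_def rho_def field_simps)

text \<open>\<open>rho\<close> is rational, so all these inequalities are plain arithmetic. This one
  caps the exponent at 5: it fails for \<open>tau ^ 6\<close>.\<close>

lemma weight_mixed: "2 * zeta ^ 2 \<le> tau ^ 5"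
  by (simp add: tau_def zeta_def rho_def field_simps)
lemma weight_unit: "zeta \<le> tau ^ 5"
  by (simp add: tau_def zeta_def rho_def field_simps)

text \<open>The left-hand side of the first bound weighs the two branches on a literal that lies in
  \<open>p\<close> of \<open>k\<close> two-literal clauses; by the second bound the worst case still
  meets the target \<open>tau ^ k\<close>.\<close>

lemma weight_star:
  assumes "2 \<le> p" "p \<le> k" "k \<le> 5"
  shows "zeta * tau ^ (k - p) + zeta ^ (1 + p) \<le> zeta * tau ^ (k - 2) + zeta ^ 3"
    "zeta * tau ^ (k - 2) + zeta ^ 3 \<le> tau ^ k"
proof -
  have p: "p = 2 \<or> p = 3 \<or> p = 4 \<or> p = 5" and k: "k = 2 \<or> k = 3 \<or> k = 4 \<or> k = 5" using assms by auto
  show "zeta * tau ^ (k - p) + zeta ^ (1 + p) \<le> zeta * tau ^ (k - 2) + zeta ^ 3"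
    using p k assms(2) by (elim disjE; simp add: tau_def zeta_def rho_def field_simps)
  show "zeta * tau ^ (k - 2) + zeta ^ 3 \<le> tau ^ k"
    using k by (elim disjE; simp add: tau_def zeta_def rho_def field_simps)
qed

text \<open>In order: few occurrences or complementary literals; a two-literal clause; many
  occurrences; a shared literal (two bounds); a negative occurrence (two bounds); positive clauses
  with \<open>d = 3\<close> and \<open>d = 4\<close>. The fourth comes closest to equality.\<close>

lemma branching_weights:
  "zeta + 2 * zeta ^ 3 \<le> 1"
  "zeta + zeta ^ 2 \<le> 1"
  "zeta + zeta * tau ^ 5 \<le> 1"
  "zeta * (zeta * tau ^ 2 + zeta ^ 3) + zeta \<le> 1"
  "zeta * (zeta * tau + zeta ^ 3) + (2 * zeta ^ 3 + zeta ^ 4) \<le> 1"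
  "zeta * tau ^ 3 + (zeta ^ 2 * tau ^ 2 + zeta ^ 3) \<le> 1"
  "zeta * tau ^ 3 + (zeta ^ 2 + zeta ^ 3 * tau ^ 2) \<le> 1"
  "zeta * tau ^ 3 + 3 * (zeta ^ 3 * tau ^ 4) \<le> 1"
  "zeta * tau ^ 4 + 4 * (zeta ^ 3 * tau ^ 5) \<le> 1"
  by (simp_all add: tau_def zeta_def rho_def field_simps)

section \<open>Families with clauses of at most two literals\<close>

text \<open>The bounds are proved by induction on \<open>card V\<close>. In \<open>bounded_family\<close> the claim is available for
  the family itself, in \<open>branching_family\<close> only after fixing at least one literal; the latter is
  the situation in the induction step.\<close>

definition bounded_family :: "'a set \<Rightarrow> 'a literal set set \<Rightarrow> 'a set set \<Rightarrow> bool" where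
  "bounded_family V F \<M> \<longleftrightarrow> supported_family V F \<M> \<and>
     (\<forall>V' F' \<M>'. supported_family (V' :: 'a set) F' \<M>' \<and> card V' \<le> card V \<longrightarrow>
        real (card \<M>') \<le> rho ^ card V')"

definition branching_family :: "'a set \<Rightarrow> 'a literal set set \<Rightarrow> 'a set set \<Rightarrow> bool" where
  "branching_family V F \<M> \<longleftrightarrow> supported_family V F \<M> \<and>
     (\<forall>L. L \<noteq> {} \<and> atom_of ` L \<subseteq> V \<longrightarrow>
        bounded_family (V - atom_of ` L) (residual F L) (agreeing \<M> L))"

lemma bounded_imp_branching:
  assumes "bounded_family V F \<M>"
  shows "branching_family V F \<M>"
proof -
  have fam: "supported_family V F \<M>" using assms by (simp add: bounded_family_def)
  have "card (V - atom_of ` L) \<le> card V" for L :: "'a literal set"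
    using supported_family_finite(1)[OF fam] by (simp add: card_mono)
  then show ?thesis
    using assms fam supported_family_residual[OF fam]
    unfolding branching_family_def bounded_family_def by (meson order_trans)
qed

lemma bounded_family_card: "bounded_family V F \<M> \<Longrightarrow> real (card \<M>) \<le> rho ^ card V"
  unfolding bounded_family_def by blast

text \<open>If some member agrees with \<open>L\<close>, then \<open>L\<close> has no complementary
  literals, so exactly \<open>card L\<close> atoms disappear; otherwise the claim is
  trivial.\<close>

lemma agreeing_weight:
  assumes fam: "supported_family V F \<M>" and L: "finite L" "atom_of ` L \<subseteq> V" and w: "w \<ge> 0"
    and bound: "real (card (agreeing \<M> L)) \<le> w * rho ^ card (V - atom_of ` L)"
  shows "real (card (agreeing \<M> L)) \<le> zeta ^ card L * w * rho ^ card V"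
proof (cases "agreeing \<M> L = {}")
  case True
  then show ?thesis using w zeta_pos rho_pos by simp
next
  case False
  then obtain M where M: "\<forall>l\<in>L. sat_literal M l" by (auto simp: agreeing_def)
  have "inj_on atom_of L"
  proof (rule inj_onI)
    fix l l' assume l: "l \<in> L" "l' \<in> L" "atom_of l = atom_of l'"
    then have "l = l' \<or> l = neg l'" by (simp add: atom_of_eq_iff)
    then show "l = l'" using M l by (metis sat_literal_neg)
  qed
  then have c: "card (atom_of ` L) = card L" by (rule card_image)
  have fV: "finite V" using supported_family_finite[OF fam] by simp
  have le: "card L \<le> card V" using card_mono[OF fV L(2)] c by simp
  have "card (V - atom_of ` L) = card V - card L"
    using card_Diff_subset[of "atom_of ` L" V] L c by simp
  then have "rho ^ card (V - atom_of ` L) = zeta ^ card L * rho ^ card V"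
    using le rho_pos by (simp add: zeta_def power_diff power_divide)
  then show ?thesis using bound by (simp add: mult_ac)
qed

lemma branching_family_supported: "branching_family V F \<M> \<Longrightarrow> supported_family V F \<M>"
  by (simp add: branching_family_def)

text \<open>The bound for small clauses enters as the hypothesis \<open>smaller\<close>, for a
  single \<open>m\<close>, which makes the lemma usable inside the induction proving that
  bound.\<close>

lemma leaf_weight_aux:
  fixes V :: "'a set"
  assumes br: "branching_family V F \<M>"
    and smaller: "\<And>V F \<M> S. bounded_family (V :: 'a set) F \<M> \<Longrightarrow> S \<subseteq> F \<Longrightarrow> card S = m \<Longrightarrow>
        (\<forall>C\<in>S. card C \<le> 2) \<Longrightarrow> real (card \<M>) \<le> tau ^ m * rho ^ card V"
    and L: "finite L" "L \<noteq> {}" "atom_of ` L \<subseteq> V"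
    and S: "S \<subseteq> F" "card S = m" "\<And>C. C \<in> S \<Longrightarrow> C \<inter> L = {}" "inj_on (\<lambda>C. C - neg ` L) S"
      "\<And>C. C \<in> S \<Longrightarrow> card (C - neg ` L) \<le> 2"
  shows "real (card (agreeing \<M> L)) \<le> zeta ^ card L * tau ^ m * rho ^ card V"
proof (rule agreeing_weight)
  show "supported_family V F \<M>" using br by (rule branching_family_supported)
  have "bounded_family (V - atom_of ` L) (residual F L) (agreeing \<M> L)"
    using br L by (simp add: branching_family_def)
  moreover have "(\<lambda>C. C - neg ` L) ` S \<subseteq> residual F L"
    using S(1,3) by (auto simp: residual_def)
  ultimately show "real (card (agreeing \<M> L)) \<le> tau ^ m * rho ^ card (V - atom_of ` L)"
    by (rule smaller) (use S in \<open>auto simp: card_image\<close>)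
qed (use L tau_pos in auto)

lemma leaf_weight_0:
  assumes "branching_family V F \<M>" "finite L" "L \<noteq> {}" "atom_of ` L \<subseteq> V"
  shows "real (card (agreeing \<M> L)) \<le> zeta ^ card L * rho ^ card V"
proof -
  have "real (card (agreeing \<M> L)) \<le> zeta ^ card L * tau ^ 0 * rho ^ card V"
    by (rule leaf_weight_aux[OF assms(1), where S = "{}"])
      (use assms(2-4) in \<open>auto dest: bounded_family_card\<close>)
  then show ?thesis by simp
qed

lemma agreeing_subset: "agreeing \<M> L \<subseteq> \<M>"
  by (auto simp: agreeing_def)

lemma card_le_add_agreeing:
  assumes fam: "supported_family V F \<M>" and "\<N> \<subseteq> agreeing \<M> L \<union> agreeing \<M> L'"
  shows "real (card \<N>) \<le> real (card (agreeing \<M> L)) + real (card (agreeing \<M> L'))"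
proof -
  have fin: "finite (agreeing \<M> L \<union> agreeing \<M> L')"
    using supported_family_finite(2)[OF fam] agreeing_subset by (metis finite_Un finite_subset)
  have "card \<N> \<le> card (agreeing \<M> L) + card (agreeing \<M> L')"
    using card_mono[OF fin assms(2)] card_Un_le le_trans by blast
  then show ?thesis by linarith
qed

text \<open>An empty clause leaves no member; a single literal is forced.\<close>

lemma unit_clause_bound:
  assumes br: "branching_family V F \<M>" and C: "C \<in> F" "card C \<le> 1"
  shows "real (card \<M>) \<le> zeta * rho ^ card V"
proof -
  note fam = branching_family_supported[OF br]
  have "finite C" using C supported_familyD(1)[OF fam] by blast
  then consider "C = {}" | l where "C = {l}"
    using C(2) by (metis card_0_eq card_1_singletonE le_neq_implies_less less_one)
  then show ?thesis
  proof cases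
    case 1
    then have "\<M> = {}" using supported_familyD(6)[OF fam _ C(1)] by blast
    then show ?thesis using zeta_pos rho_pos by simp
  next
    case 2
    then have "\<M> = agreeing \<M> {l}" 
      using supported_familyD(6)[OF fam _ C(1)] by (auto simp: agreeing_def)
    moreover have "real (card (agreeing \<M> {l})) \<le> zeta ^ card {l} * rho ^ card V"
      by (rule leaf_weight_0[OF br]) (use 2 supported_familyD(4)[OF fam C(1)] in auto)
    ultimately show ?thesis by simp
  qed
qed

text \<open>If \<open>l\<close> holds, the second clause forces \<open>q\<close>; otherwise the
  first one forces \<open>p\<close>. Each branch fixes two distinct literals, as no clause is a
  tautology.\<close>

lemma mixed_pair_bound:
  assumes br: "branching_family V F \<M>" and C: "{l, p} \<in> F" "{neg l, q} \<in> F" "p \<noteq> l" "q \<noteq> neg l"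
  shows "real (card \<M>) \<le> 2 * zeta ^ 2 * rho ^ card V"
proof -
  note fam = branching_family_supported[OF br]
  have ne: "p \<noteq> neg l" "q \<noteq> l"
    using supported_familyD(5)[OF fam C(1), of l] supported_familyD(5)[OF fam C(2), of l] C by auto
  have cover: "\<M> \<subseteq> agreeing \<M> {l, q} \<union> agreeing \<M> {neg l, p}"
    using supported_familyD(6)[OF fam _ C(1)] supported_familyD(6)[OF fam _ C(2)]
    by (auto simp: agreeing_def)
  have "real (card (agreeing \<M> {l, q})) \<le> zeta ^ card {l, q} * rho ^ card V"
    by (rule leaf_weight_0[OF br])
      (use supported_familyD(4)[OF fam C(1)] supported_familyD(4)[OF fam C(2)] in auto)
  moreover have "real (card (agreeing \<M> {neg l, p})) \<le> zeta ^ card {neg l, p} * rho ^ card V"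
    by (rule leaf_weight_0[OF br])
      (use supported_familyD(4)[OF fam C(1)] supported_familyD(4)[OF fam C(2)] in auto)
  ultimately show ?thesis
    using card_le_add_agreeing[OF fam cover] ne C(3,4) by (simp add: numeral_2_eq_2)
qed

lemma card_2_other:
  assumes "card C = 2" "l \<in> C"
  obtains m where "C = {l, m}" "m \<noteq> l"
  using assms by (metis card_2_iff doubleton_eq_iff insertE singletonD)

text \<open>Branching on \<open>l\<close>: making it false forces the other literal of each of the \<open>p \<ge> 2\<close> clauses with
  \<open>l\<close>, making it true leaves the other \<open>k - p\<close> clauses; the worst case is \<open>p = 2\<close>.\<close>

lemma star_bound_aux:
  fixes V :: "'a set"
  assumes br: "branching_family V F \<M>"
    and smaller: "\<And>m V F \<M> S. m < k \<Longrightarrow> bounded_family (V :: 'a set) F \<M> \<Longrightarrow> S \<subseteq> F \<Longrightarrow>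
        card S = m \<Longrightarrow> (\<forall>C\<in>S. card C \<le> 2) \<Longrightarrow> real (card \<M>) \<le> tau ^ m * rho ^ card V"
    and S: "S \<subseteq> F" "card S = k" "k \<le> 5" "\<And>C. C \<in> S \<Longrightarrow> card C = 2"
    and l: "\<And>C. C \<in> S \<Longrightarrow> neg l \<notin> C" "C1 \<in> S" "C2 \<in> S" "C1 \<noteq> C2" "l \<in> C1" "l \<in> C2"
  shows "real (card \<M>) \<le> (zeta * tau ^ (k - 2) + zeta ^ 3) * rho ^ card V"
proof -
  note fam = branching_family_supported[OF br]
  have finS: "finite S" using S(1) supported_family_finite(3)[OF fam] finite_subset by blast
  define D where "D = {C \<in> S. l \<in> C}"
  define N where "N = {m. m \<noteq> l \<and> {l, m} \<in> S}"
  define p where "p = card D"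
  have DN: "D = (\<lambda>m. {l, m}) ` N"
  proof
    show "D \<subseteq> (\<lambda>m. {l, m}) ` N"
    proof
      fix C assume C: "C \<in> D"
      then obtain m where "C = {l, m}" "m \<noteq> l" using card_2_other S(4) by (metis (lifting) D_def mem_Collect_eq)
      then show "C \<in> (\<lambda>m. {l, m}) ` N" using C by (auto simp: D_def N_def)
    qed
  qed (auto simp: D_def N_def)
  have inj: "inj_on (\<lambda>m. {l, m}) N" by (auto simp: inj_on_def doubleton_eq_iff)
  have finD: "finite D" using finS by (simp add: D_def)
  have finN: "finite N" using finD inj DN finite_image_iff by metis
  have cN: "card N = p" using DN inj by (simp add: p_def card_image)
  have "card {C1, C2} \<le> card D" using l finD by (intro card_mono) (auto simp: D_def)
  then have p2: "2 \<le> p" using l by (simp add: p_def)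
  have pk: "p \<le> k" using finS S(2) by (auto simp: p_def D_def intro: card_mono)
  have negN: "neg l \<notin> N" using l(1) by (auto simp: N_def)
  have lV: "atom_of l \<in> V" using S(1) l(2,5) supported_familyD(4)[OF fam] by blast
  have NV: "atom_of ` N \<subseteq> V"
    using S(1) supported_familyD(4)[OF fam] by (fastforce simp: N_def)
  \<comment> \<open>Where \<open>l\<close> is false all of \<open>N\<close> is forced, so this
    branch fixes \<open>1 + p\<close> literals.\<close>
  have cover: "\<M> \<subseteq> agreeing \<M> {l} \<union> agreeing \<M> (insert (neg l) N)"
  proof
    fix M assume M: "M \<in> \<M>"
    have "sat_literal M m" if "m \<in> N" "\<not> sat_literal M l" for m
      using supported_familyD(6)[OF fam M, of "{l, m}"] that S(1) by (auto simp: N_def)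
    then show "M \<in> agreeing \<M> {l} \<union> agreeing \<M> (insert (neg l) N)"
      using M by (auto simp: agreeing_def)
  qed
  have DS: "D \<subseteq> S" by (auto simp: D_def)
  \<comment> \<open>The clauses in \<open>S - D\<close> contain neither \<open>l\<close> nor
    \<open>neg l\<close> and pass to this branch unchanged.\<close>
  have 1: "real (card (agreeing \<M> {l})) \<le> zeta ^ card {l} * tau ^ (k - p) * rho ^ card V"
  proof (rule leaf_weight_aux[OF br, where S = "S - D"])
    show "real (card \<M>) \<le> tau ^ (k - p) * rho ^ card V"
      if "bounded_family V F \<M>" "S \<subseteq> F" "card S = k - p" "\<forall>C\<in>S. card C \<le> 2"
      for V :: "'a set" and F \<M> S
      using smaller[OF _ that] p2 pk by simp
    show "card (S - D) = k - p" using card_Diff_subset[OF finD DS] S(2) by (simp add: p_def)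
    show "inj_on (\<lambda>C. C - neg ` {l}) (S - D)" using l(1) by (auto simp: inj_on_def)
    show "card (C - neg ` {l}) \<le> 2" if "C \<in> S - D" for C
      using l(1)[of C] S(4)[of C] that by simp
  qed (use S(1) lV in \<open>auto simp: D_def\<close>)
  have 2: "real (card (agreeing \<M> (insert (neg l) N)))
      \<le> zeta ^ card (insert (neg l) N) * rho ^ card V"
    by (rule leaf_weight_0[OF br]) (use lV NV finN in auto)
  have "real (card \<M>) \<le> (zeta * tau ^ (k - p) + zeta ^ (1 + p)) * rho ^ card V"
    using card_le_add_agreeing[OF fam cover] 1 2 negN finN cN by (simp add: algebra_simps)
  also have "\<dots> \<le> (zeta * tau ^ (k - 2) + zeta ^ 3) * rho ^ card V"
    using weight_star(1)[OF p2 pk S(3)] rho_pos by (intro mult_right_mono) auto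
  finally show ?thesis .
qed

lemma tau_power_ge:
  assumes "k \<le> 5" "w \<le> tau ^ 5"
  shows "w * rho ^ n \<le> tau ^ k * rho ^ n"
proof -
  have "tau ^ 5 \<le> tau ^ k" using assms(1) tau_pos tau_less_1 by (intro power_decreasing) auto
  then show ?thesis using assms rho_pos by (intro mult_right_mono) auto
qed

text \<open>Strong induction on \<open>k\<close>. A unit clause or a complementary pair already
  gains \<open>tau ^ 5\<close>, and a repeated literal gives a star. Otherwise a chosen clause
  shares no atom with the rest, so branching on it leaves the rest intact and gains
  \<open>zeta + zeta ^ 2 = tau\<close>.\<close>

lemma small_clauses_bound:
  assumes "bounded_family (V :: 'a set) F \<M>" "S \<subseteq> F" "card S = k" "k \<le> 5" "\<forall>C\<in>S. card C \<le> 2"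
  shows "real (card \<M>) \<le> tau ^ k * rho ^ card V"
  using assms
proof (induction k arbitrary: V F \<M> S rule: less_induct)
  case (less k)
  note br = bounded_imp_branching[OF less.prems(1)]
  note fam = branching_family_supported[OF br]
  note S = less.prems(2-5)
  have finS: "finite S" using S(1) supported_family_finite(3)[OF fam] finite_subset by blast
  have smaller: "real (card \<M>) \<le> tau ^ m * rho ^ card V"
    if "m < k" "bounded_family V F \<M>" "S \<subseteq> F" "card S = m" "\<forall>C\<in>S. card C \<le> 2"
    for m and V :: "'a set" and F \<M> S
    using less.IH[OF that(1-4)] that S(3) by simp
  consider (unit) C where "C \<in> S" "card C \<le> 1"
    | (mixed) C1 C2 l where "\<forall>C\<in>S. card C = 2" "C1 \<in> S" "C2 \<in> S" "l \<in> C1" "neg l \<in> C2"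
    | (star) C1 C2 l where "\<forall>C\<in>S. card C = 2" "\<forall>C\<in>S. neg l \<notin> C" "C1 \<in> S" "C2 \<in> S"
        "C1 \<noteq> C2" "l \<in> C1" "l \<in> C2"
    | (empty) "S = {}"
    | (matching) C where "\<forall>C\<in>S. card C = 2" "C \<in> S"
        "\<And>C' l. C' \<in> S \<Longrightarrow> C' \<noteq> C \<Longrightarrow> l \<in> C \<Longrightarrow> l \<notin> C' \<and> neg l \<notin> C'"
  proof -
    show thesis
    proof (cases "S = {} \<or> (\<exists>C\<in>S. card C \<le> 1)")
      case True
      then show thesis using unit empty by blast
    next
      case False
      have two: "\<forall>C\<in>S. card C = 2"
      proof
        fix C assume "C \<in> S"
        then have "card C \<le> 2" "\<not> card C \<le> 1" using False S(4) by blast+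
        then show "card C = 2" by linarith
      qed
      obtain C where C: "C \<in> S" using False by blast
      show thesis
      proof (cases "\<exists>C1\<in>S. \<exists>C2\<in>S. \<exists>l\<in>C1. neg l \<in> C2")
        case True
        then show thesis using mixed[OF two] by blast
      next
        case no_mixed: False
        show thesis
        proof (cases "\<exists>C'\<in>S. \<exists>l\<in>C. C' \<noteq> C \<and> l \<in> C'")
          case True
          then obtain C' l where C': "C' \<in> S" "l \<in> C" "C' \<noteq> C" "l \<in> C'" by blast
          have "\<forall>C\<in>S. neg l \<notin> C" using no_mixed C' by blast
          then show thesis using star[OF two _ C'(1) C C'(3,4,2)] by blast
        next
          case False
          show thesis
            by (rule matching[OF two C]) (use False no_mixed C in blast)
        qed
      qed
    qed
  qed
  then show ?case
  proof cases
    case unit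
    then show ?thesis
      using unit_clause_bound[OF br, of C] S(1,3) tau_power_ge[OF _ weight_unit, of k "card V"]
      by fastforce
  next
    case mixed
    obtain p where p: "C1 = {l, p}" "p \<noteq> l" using mixed card_2_other by metis
    obtain q where q: "C2 = {neg l, q}" "q \<noteq> neg l" using mixed card_2_other by metis
    have "real (card \<M>) \<le> 2 * zeta ^ 2 * rho ^ card V"
      by (rule mixed_pair_bound[OF br]) (use p q mixed S(1) in auto)
    then show ?thesis using tau_power_ge[OF S(3) weight_mixed, of "card V"] by simp
  next
    case star
    have "card {C1, C2} \<le> card S" using star finS by (intro card_mono) auto
    then have k: "2 \<le> k" using star(5) S(2) by simp
    have "real (card \<M>) \<le> (zeta * tau ^ (k - 2) + zeta ^ 3) * rho ^ card V"
      by (rule star_bound_aux[OF br smaller, where S = S and ?C1.0 = C1 and ?C2.0 = C2 and l = l]) (use star S in auto)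
    also have "\<dots> \<le> tau ^ k * rho ^ card V"
      using weight_star(2)[of 2 k] k S(3) rho_pos by (intro mult_right_mono) auto
    finally show ?thesis .
  next
    case empty
    then show ?thesis using less.prems(1) S(2) by (auto simp: bounded_family_def)
  next
    case matching
    have cS: "C \<in> F" using matching S(1) by blast
    obtain l where "l \<in> C" using matching by fastforce
    then obtain m where m: "C = {l, m}" "m \<noteq> l" using matching card_2_other by metis
    have V: "atom_of l \<in> V" "atom_of m \<in> V"
      using m cS supported_familyD(4)[OF fam] by blast+
    have ml: "m \<noteq> neg l" using supported_familyD(5)[OF fam cS, of l] m by auto
    have k: "k \<noteq> 0" using S(2) matching(2) finS card_0_eq by blast
    have other: "C' \<inter> {l, m} = {}" "C' \<inter> neg ` {l, m} = {}" if "C' \<in> S - {C}" for C'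
      using matching(3)[of C'] that m by auto
    have cover: "\<M> \<subseteq> agreeing \<M> {l} \<union> agreeing \<M> {neg l, m}"
      using supported_familyD(6)[OF fam _ cS] m by (auto simp: agreeing_def)
    have leaf: "real (card (agreeing \<M> L)) \<le> zeta ^ card L * tau ^ (k - 1) * rho ^ card V"
      if L: "L = {l} \<or> L = {neg l, m}" for L
    proof (rule leaf_weight_aux[OF br, where S = "S - {C}"])
      show "real (card \<M>) \<le> tau ^ (k - 1) * rho ^ card V"
        if "bounded_family V F \<M>" "S \<subseteq> F" "card S = k - 1" "\<forall>C\<in>S. card C \<le> 2"
        for V :: "'a set" and F \<M> S
        using smaller[OF _ that] k by simp
      show "card (S - {C}) = k - 1" using matching(2) S(2) by simp
      have d: "C' - neg ` L = C'" if "C' \<in> S - {C}" for C'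
        using other[OF that] L by auto
      then show "inj_on (\<lambda>C. C - neg ` L) (S - {C})" by (metis (no_types, lifting) inj_onI)
      show "card (C' - neg ` L) \<le> 2" if "C' \<in> S - {C}" for C' using d[OF that] S(4) that by simp
      show "C' \<inter> L = {}" if "C' \<in> S - {C}" for C' using other[OF that] L by auto
    qed (use L V S(1) in auto)
    have "card {neg l, m} = 2" using ml by auto
    then have "real (card \<M>)
        \<le> zeta * tau ^ (k - 1) * rho ^ card V + zeta ^ 2 * tau ^ (k - 1) * rho ^ card V"
      using card_le_add_agreeing[OF fam cover] leaf[of "{l}"] leaf[of "{neg l, m}"] by simp
    also have "\<dots> = (zeta + zeta ^ 2) * tau ^ (k - 1) * rho ^ card V"
      by (simp add: algebra_simps)
    also have "(zeta + zeta ^ 2) * tau ^ (k - 1) = tau ^ k"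
      using k by (cases k) (simp_all add: tau_def)
    finally show ?thesis .
  qed
qed

section \<open>Branches that leave up to five two-literal clauses\<close>

lemma branching_family_residual:
  assumes "branching_family V F \<M>" "L \<noteq> {}" "atom_of ` L \<subseteq> V"
  shows "bounded_family (V - atom_of ` L) (residual F L) (agreeing \<M> L)"
  using assms by (simp add: branching_family_def)

lemma leaf_weight:
  assumes br: "branching_family V F \<M>" and L: "finite L" "L \<noteq> {}" "atom_of ` L \<subseteq> V"
    and S: "S \<subseteq> F" "k \<le> card S" "k \<le> 5" "\<And>C. C \<in> S \<Longrightarrow> C \<inter> L = {}" "inj_on (\<lambda>C. C - neg ` L) S"
      "\<And>C. C \<in> S \<Longrightarrow> card (C - neg ` L) \<le> 2"
  shows "real (card (agreeing \<M> L)) \<le> zeta ^ card L * tau ^ k * rho ^ card V"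
proof -
  obtain S' where S': "S' \<subseteq> S" "card S' = k" using S(2) obtain_subset_with_card_n by metis
  show ?thesis
  proof (rule leaf_weight_aux[OF br small_clauses_bound L, where S = S'])
    show "inj_on (\<lambda>C. C - neg ` L) S'" using S(5) S'(1) inj_on_subset by blast
  qed (use S S' in auto)
qed

text \<open>Clauses of \<open>S\<close> that lose only \<open>neg l\<close> stay distinct; if some clause loses more, a unit clause
  arises, whose factor \<open>\<zeta>\<close> is below \<open>\<tau>\<^sup>5\<close>.\<close>

lemma leaf_weight_common:
  assumes br: "branching_family V F \<M>" and L: "finite L" "atom_of ` L \<subseteq> V" "l \<in> L"
    and S: "S \<subseteq> F" "k \<le> card S" "k \<le> 5" "\<And>C. C \<in> S \<Longrightarrow> C \<inter> L = {}" "\<And>C. C \<in> S \<Longrightarrow> neg l \<in> C"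
  shows "real (card (agreeing \<M> L)) \<le> zeta ^ card L * tau ^ k * rho ^ card V"
proof (cases "\<exists>C\<in>S. card (C - neg ` L) \<le> 1")
  case True
  then obtain C where C: "C \<in> S" "card (C - neg ` L) \<le> 1" by blast
  note fam = branching_family_supported[OF br]
  have "L \<noteq> {}" using L by blast
  then have "branching_family (V - atom_of ` L) (residual F L) (agreeing \<M> L)"
    using bounded_imp_branching[OF branching_family_residual[OF br _ L(2)]] by blast
  moreover have "C - neg ` L \<in> residual F L" using C S by (auto simp: residual_def)
  ultimately have "real (card (agreeing \<M> L)) \<le> zeta * rho ^ card (V - atom_of ` L)"
    using C(2) unit_clause_bound by blast
  also have "\<dots> \<le> tau ^ k * rho ^ card (V - atom_of ` L)"
    using tau_power_ge[OF S(3) weight_unit] .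
  finally show ?thesis
    using tau_pos by (intro agreeing_weight[OF fam L(1,2)]) auto
next
  case False
  note fam = branching_family_supported[OF br]
  have decomp: "C = insert (neg l) (C - neg ` L)" "card (C - neg ` L) \<le> 2" if C: "C \<in> S" for C
  proof -
    have C3: "finite C" "card C \<le> 3"
      using C S(1) supported_familyD(1,2)[OF fam] by blast+
    have l: "neg l \<in> C" "neg l \<in> neg ` L" using S(5) C L(3) by auto
    have sub: "C - neg ` L \<subseteq> C - {neg l}" using l by blast
    have c2: "card (C - {neg l}) \<le> 2" using l C3 by simp
    have "\<not> card (C - neg ` L) \<le> 1" using False C by blast
    \<comment> \<open>At most two literals remain besides \<open>neg l\<close>, and a non-unit
      residue has at least two. So nothing else is lost, and \<open>C\<close> can be recovered from
      its residue.\<close>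
    then have "C - neg ` L = C - {neg l}"
      using card_seteq[OF _ sub] c2 C3(1) by auto
    then show "C = insert (neg l) (C - neg ` L)" "card (C - neg ` L) \<le> 2" using l c2 by auto
  qed
  show ?thesis
  proof (rule leaf_weight[OF br L(1) _ L(2) S(1-4)])
    show "inj_on (\<lambda>C. C - neg ` L) S" using decomp(1) by (metis (no_types, lifting) inj_onI)
  qed (use L decomp(2) in auto)
qed

section \<open>Branching on an atom\<close>

definition occ :: "'a literal set set \<Rightarrow> 'a \<Rightarrow> 'a literal set set" where
  "occ F a = {C \<in> F. Pos a \<in> C}"

definition critical :: "'a \<Rightarrow> 'a literal set \<Rightarrow> 'a literal set" where
  "critical a C = insert (Pos a) (neg ` (C - {Pos a}))"

lemma finite_occ: "supported_family V F \<M> \<Longrightarrow> finite (occ F a)"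
  using supported_family_finite(3)[of V F \<M>] by (simp add: occ_def)

text \<open>The support condition turned into a branching. Branches may overlap, which is harmless
  for an upper bound.\<close>

lemma critical_cover:
  assumes fam: "supported_family V F \<M>" and a: "a \<in> V"
  shows "agreeing \<M> {Pos a} \<subseteq> (\<Union>C\<in>occ F a. agreeing \<M> (critical a C))"
proof
  fix M assume M: "M \<in> agreeing \<M> {Pos a}"
  then have "M \<in> \<M>" "a \<in> M" by (auto simp: agreeing_def)
  then obtain C where "C \<in> F" "Pos a \<in> C" "\<forall>l\<in>C - {Pos a}. \<not> sat_literal M l"
    using supported_familyD(7)[OF fam] a by blast
  then show "M \<in> (\<Union>C\<in>occ F a. agreeing \<M> (critical a C))"
    using \<open>M \<in> \<M>\<close> \<open>a \<in> M\<close> by (auto simp: occ_def critical_def agreeing_def intro!: bexI[of _ C])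
qed

lemma critical_props:
  assumes fam: "supported_family V F \<M>" and C: "C \<in> occ F a"
  shows "finite (critical a C)" "critical a C \<noteq> {}" "atom_of ` critical a C \<subseteq> V"
    "card (critical a C) = card C"
proof -
  have CF: "C \<in> F" "Pos a \<in> C" using C by (auto simp: occ_def)
  have fin: "finite C" using supported_familyD(1)[OF fam CF(1)] .
  show "finite (critical a C)" "critical a C \<noteq> {}" using fin by (auto simp: critical_def)
  show "atom_of ` critical a C \<subseteq> V"
    using supported_familyD(4)[OF fam CF(1)] CF(2) by (force simp: critical_def)
  \<comment> \<open>Otherwise \<open>C\<close> would contain \<open>Neg a\<close> beside
    \<open>Pos a\<close>.\<close>
  have n: "Pos a \<notin> neg ` (C - {Pos a})"
    using supported_familyD(5)[OF fam CF(1,2)] by (metis DiffE imageE neg_neg)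
  have "card (critical a C) = Suc (card (C - {Pos a}))"
    unfolding critical_def using fin n by (subst card_insert_disjoint) (auto simp: card_image inj_on_def)
  then show "card (critical a C) = card C"
    using fin CF(2) by (metis card_Suc_Diff1)
qed

lemma pos_branch_sum:
  fixes w :: real
  assumes fam: "supported_family V F \<M>" and a: "a \<in> V"
    and w: "\<And>C. C \<in> occ F a \<Longrightarrow> real (card (agreeing \<M> (critical a C))) \<le> w"
  shows "real (card (agreeing \<M> {Pos a})) \<le> card (occ F a) * w"
proof -
  have fin: "finite (\<Union>C\<in>occ F a. agreeing \<M> (critical a C))"
    using finite_occ[OF fam] supported_family_finite(2)[OF fam] agreeing_subset
    by (metis finite_UN_I finite_subset)
  have "card (agreeing \<M> {Pos a}) \<le> (\<Sum>C\<in>occ F a. card (agreeing \<M> (critical a C)))"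
    using card_mono[OF fin critical_cover[OF fam a]] card_UN_le[OF finite_occ[OF fam]] le_trans by blast
  then have "real (card (agreeing \<M> {Pos a})) \<le> (\<Sum>C\<in>occ F a. real (card (agreeing \<M> (critical a C))))"
    by (metis of_nat_le_iff of_nat_sum)
  also have "\<dots> \<le> card (occ F a) * w"
    using sum_bounded_above[of "occ F a" "\<lambda>C. real (card (agreeing \<M> (critical a C)))" w] w by simp
  finally show ?thesis .
qed

lemma two_branches:
  assumes fam: "supported_family V F \<M>"
    and "\<M> \<subseteq> agreeing \<M> L \<union> agreeing \<M> L'"
    and "real (card (agreeing \<M> L)) \<le> w * rho ^ card V"
    and "real (card (agreeing \<M> L')) \<le> w' * rho ^ card V" and "w + w' \<le> 1"
  shows "real (card \<M>) \<le> rho ^ card V"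
proof -
  have "real (card \<M>) \<le> (w + w') * rho ^ card V"
    using card_le_add_agreeing[OF fam assms(2)] assms(3,4) by (simp add: algebra_simps)
  also have "\<dots> \<le> 1 * rho ^ card V"
    using assms(5) rho_pos by (intro mult_right_mono) auto
  finally show ?thesis by simp
qed

lemma split_atom: "\<M> \<subseteq> agreeing \<M> {Neg a} \<union> agreeing \<M> {Pos a}"
  by (auto simp: agreeing_def)

lemma single_branch:
  assumes br: "branching_family V F \<M>" and "atom_of l \<in> V"
  shows "real (card (agreeing \<M> {l})) \<le> zeta * rho ^ card V"
  using leaf_weight_0[OF br, of "{l}"] assms by simp

text \<open>The clauses at \<open>a\<close> lose only \<open>Pos a\<close>, so they stay distinct
  and keep at most two literals.\<close>

lemma neg_branch:
  assumes br: "branching_family V F \<M>" and a: "a \<in> V" and k: "k \<le> card (occ F a)" "k \<le> 5"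
  shows "real (card (agreeing \<M> {Neg a})) \<le> zeta * tau ^ k * rho ^ card V"
proof -
  note fam = branching_family_supported[OF br]
  have "real (card (agreeing \<M> {Neg a})) \<le> zeta ^ card {Neg a} * tau ^ k * rho ^ card V"
  proof (rule leaf_weight_common[OF br, where S = "occ F a" and l = "Neg a"])
    show "C \<inter> {Neg a} = {}" if "C \<in> occ F a" for C
      using supported_familyD(5)[OF fam, of C "Pos a"] that by (auto simp: occ_def)
  qed (use a k in \<open>auto simp: occ_def\<close>)
  then show ?thesis by simp
qed

section \<open>The single cases of the branching\<close>

lemma case_small_clause:
  assumes br: "branching_family V F \<M>" and C: "C \<in> F" "card C \<le> 2"
  shows "real (card \<M>) \<le> rho ^ card V"
proof (cases "card C = 2")
  case False
  then have "real (card \<M>) \<le> zeta * rho ^ card V" using C unit_clause_bound[OF br C(1)] by simp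
  also have "\<dots> \<le> 1 * rho ^ card V"
    using zeta_less_1 rho_pos by (intro mult_right_mono) auto
  finally show ?thesis by simp
next
  case True
  note fam = branching_family_supported[OF br]
  obtain l m where lm: "C = {l, m}" "l \<noteq> m" using True by (meson card_2_iff)
  have ml: "m \<noteq> neg l" using supported_familyD(5)[OF fam C(1), of l] lm by auto
  have V: "atom_of l \<in> V" "atom_of m \<in> V" using supported_familyD(4)[OF fam C(1)] lm by auto
  show ?thesis
  proof (rule two_branches[OF fam _ single_branch[OF br V(1)] _ branching_weights(2)])
    show "\<M> \<subseteq> agreeing \<M> {l} \<union> agreeing \<M> {neg l, m}"
      using supported_familyD(6)[OF fam _ C(1)] lm by (auto simp: agreeing_def)
    show "real (card (agreeing \<M> {neg l, m})) \<le> zeta\<^sup>2 * rho ^ card V"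
      using leaf_weight_0[OF br, of "{neg l, m}"] V ml by (simp add: numeral_2_eq_2)
  qed
qed

text \<open>Guessing the critical clause of a true \<open>a\<close> fixes three literals, in at most
  two ways.\<close>

lemma case_few_occurrences:
  assumes br: "branching_family V F \<M>" and three: "\<forall>C\<in>F. card C = 3"
    and a: "a \<in> V" "card (occ F a) \<le> 2"
  shows "real (card \<M>) \<le> rho ^ card V"
proof -
  note fam = branching_family_supported[OF br]
  show ?thesis
  proof (rule two_branches[OF fam split_atom single_branch[OF br] _ branching_weights(1)])
    have "real (card (agreeing \<M> {Pos a})) \<le> card (occ F a) * (zeta ^ 3 * rho ^ card V)"
    proof (rule pos_branch_sum[OF fam a(1)])
      fix C assume C: "C \<in> occ F a"
      then have "card C = 3" using three by (auto simp: occ_def)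
      then show "real (card (agreeing \<M> (critical a C))) \<le> zeta ^ 3 * rho ^ card V"
        using leaf_weight_0[OF br critical_props(1-3)[OF fam C]] critical_props(4)[OF fam C] by simp
    qed
    also have "\<dots> \<le> 2 * (zeta ^ 3 * rho ^ card V)"
      using a(2) zeta_pos rho_pos by (intro mult_right_mono) auto
    finally show "real (card (agreeing \<M> {Pos a})) \<le> 2 * zeta ^ 3 * rho ^ card V" by simp
  qed (use a in simp)
qed

lemma case_many_occurrences:
  assumes br: "branching_family V F \<M>" and a: "a \<in> V" "5 \<le> card (occ F a)"
  shows "real (card \<M>) \<le> rho ^ card V"
  using two_branches[OF branching_family_supported[OF br] split_atom neg_branch[OF br a] single_branch[OF br]]
    branching_weights(3) a by simp

text \<open>Making \<open>a\<close> false leaves the pair \<open>{l, p}\<close>,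
  \<open>{neg l, q}\<close> of weight \<open>2 * zeta ^ 2\<close>; then \<open>a\<close> true needs
  no gain beyond its own factor \<open>zeta\<close>.\<close>

lemma case_mixed:
  assumes br: "branching_family V F \<M>" and three: "\<forall>C\<in>F. card C = 3"
    and C: "C1 \<in> occ F a" "C2 \<in> occ F a" "l \<in> C1" "neg l \<in> C2"
  shows "real (card \<M>) \<le> rho ^ card V"
proof -
  note fam = branching_family_supported[OF br]
  have CF: "C1 \<in> F" "C2 \<in> F" "Pos a \<in> C1" "Pos a \<in> C2" using C by (auto simp: occ_def)
  have a: "a \<in> V" using supported_familyD(4)[OF fam CF(1,3)] by simp
  have Na: "Neg a \<notin> C1" "Neg a \<notin> C2"
    using supported_familyD(5)[OF fam CF(1,3)] supported_familyD(5)[OF fam CF(2,4)] by auto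
  have la: "l \<noteq> Pos a" "l \<noteq> Neg a" using Na C by auto
  then have nla: "neg l \<noteq> Pos a" by (metis neg.simps(1) neg_neg)
  obtain p where p: "C1 - {Pos a} = {l, p}" "p \<noteq> l"
    using card_2_other[of "C1 - {Pos a}" l] three CF C(3) la by auto
  obtain q where q: "C2 - {Pos a} = {neg l, q}" "q \<noteq> neg l"
    using card_2_other[of "C2 - {Pos a}" "neg l"] three CF C(4) nla by auto
  have "bounded_family (V - atom_of ` {Neg a}) (residual F {Neg a}) (agreeing \<M> {Neg a})"
    using branching_family_residual[OF br, of "{Neg a}"] a by simp
  moreover have "C - {Pos a} \<in> residual F {Neg a}" if "C \<in> F" "Neg a \<notin> C" for C
    using that by (auto simp: residual_def)
  ultimately have "real (card (agreeing \<M> {Neg a})) \<le> 2 * zeta ^ 2 * rho ^ card (V - atom_of ` {Neg a})"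
    using mixed_pair_bound[OF bounded_imp_branching, of _ _ _ l p q] CF Na p q by metis
  then have "real (card (agreeing \<M> {Neg a})) \<le> zeta ^ card {Neg a} * (2 * zeta ^ 2) * rho ^ card V"
    using a by (intro agreeing_weight[OF fam]) auto
  then have "real (card (agreeing \<M> {Neg a})) \<le> 2 * zeta ^ 3 * rho ^ card V"
    by (simp add: power3_eq_cube power2_eq_square mult_ac)
  then show ?thesis
    using two_branches[OF fam split_atom _ single_branch[OF br]] branching_weights(1) a by simp
qed

lemma star_bound:
  assumes "bounded_family V F \<M>" "S \<subseteq> F" "card S = k" "k \<le> 5" "\<And>C. C \<in> S \<Longrightarrow> card C = 2"
    "\<And>C. C \<in> S \<Longrightarrow> neg l \<notin> C" "C1 \<in> S" "C2 \<in> S" "C1 \<noteq> C2" "l \<in> C1" "l \<in> C2"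
  shows "real (card \<M>) \<le> (zeta * tau ^ (k - 2) + zeta ^ 3) * rho ^ card V"
  by (rule star_bound_aux[OF bounded_imp_branching[OF assms(1)] small_clauses_bound assms(2-11)])
    (use assms(4) in auto)

lemma card_3_other:
  assumes "card C = 3" "l \<in> C" "m \<in> C" "l \<noteq> m"
  obtains p where "C = {l, m, p}" "p \<noteq> l" "p \<noteq> m"
proof -
  have "card (C - {l}) = 2" using assms by simp
  then obtain p where "C - {l} = {m, p}" "p \<noteq> m" using card_2_other[of "C - {l}" m] assms by blast
  then show thesis using assms(2) by (intro that[of p]) auto
qed

text \<open>With \<open>a\<close> false, the shortened clauses contain a star at \<open>l\<close>,
  which suffices for four occurrences. For three, \<open>a\<close> true must gain as well:
  \<open>C2\<close> is considered only where \<open>C1\<close> is not critical, which fixes a fourth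
  literal.\<close>

lemma case_shared:
  assumes br: "branching_family V F \<M>" and three: "\<forall>C\<in>F. card C = 3"
    and unmixed: "\<And>C1 C2 l. C1 \<in> occ F a \<Longrightarrow> C2 \<in> occ F a \<Longrightarrow> l \<in> C1 \<Longrightarrow> neg l \<notin> C2"
    and C: "C1 \<in> occ F a" "C2 \<in> occ F a" "l \<in> C1" "l \<in> C2" "C1 \<noteq> C2" "l \<noteq> Pos a"
    and k: "card (occ F a) = 3 \<or> card (occ F a) = 4"
  shows "real (card \<M>) \<le> rho ^ card V"
proof -
  note fam = branching_family_supported[OF br]
  define k where "k = card (occ F a)"
  have CF: "C1 \<in> F" "C2 \<in> F" "Pos a \<in> C1" "Pos a \<in> C2" using C by (auto simp: occ_def)
  have a: "a \<in> V" using supported_familyD(4)[OF fam CF(1,3)] by simp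
  have Na: "Neg a \<notin> C" if "C \<in> occ F a" for C
    using unmixed[OF that that, of "Pos a"] that by (auto simp: occ_def)
  define S where "S = (\<lambda>C. C - {Pos a}) ` occ F a"
  have inj: "inj_on (\<lambda>C. C - {Pos a}) (occ F a)"
    by (rule inj_onI) (auto simp: occ_def)
  have "real (card (agreeing \<M> {Neg a})) \<le> (zeta * tau ^ (k - 2) + zeta ^ 3) * rho ^ card (V - atom_of ` {Neg a})"
  proof (rule star_bound[where S = S and ?C1.0 = "C1 - {Pos a}" and ?C2.0 = "C2 - {Pos a}" and l = l])
    show "bounded_family (V - atom_of ` {Neg a}) (residual F {Neg a}) (agreeing \<M> {Neg a})"
      by (rule branching_family_residual[OF br]) (use a in auto)
    show "S \<subseteq> residual F {Neg a}"
      using Na by (auto simp: S_def residual_def occ_def)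
    show "card S = k" using inj by (simp add: S_def k_def card_image)
    show "k \<le> 5" using k by (auto simp: k_def)
    show "card C = 2" if "C \<in> S" for C
      using that three by (auto simp: S_def occ_def)
    show "neg l \<notin> C" if "C \<in> S" for C
      using that unmixed[OF C(1) _ C(3)] by (auto simp: S_def)
    show "C1 - {Pos a} \<noteq> C2 - {Pos a}" using inj C by (auto dest: inj_onD)
  qed (use C in \<open>auto simp: S_def\<close>)
  then have "real (card (agreeing \<M> {Neg a}))
      \<le> zeta ^ card {Neg a} * (zeta * tau ^ (k - 2) + zeta ^ 3) * rho ^ card V"
    using a zeta_pos tau_pos by (intro agreeing_weight[OF fam]) auto
  then have n: "real (card (agreeing \<M> {Neg a}))
      \<le> zeta * (zeta * tau ^ (k - 2) + zeta ^ 3) * rho ^ card V" by simp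
  show ?thesis
  proof (cases "k = 4")
    case True
    then show ?thesis
      using two_branches[OF fam split_atom n single_branch[OF br]] branching_weights(4) a by simp
  next
    case False
    then have k3: "k = 3" using k by (auto simp: k_def)
    then obtain C3 where C3: "occ F a = {C1, C2, C3}"
      using card_3_other[of "occ F a" C1 C2] C k_def by metis
    obtain p where p: "C1 = {Pos a, l, p}" "p \<noteq> Pos a" "p \<noteq> l"
      using card_3_other[of C1 "Pos a" l] three CF C by metis
    obtain q where q: "C2 = {Pos a, l, q}" "q \<noteq> Pos a" "q \<noteq> l"
      using card_3_other[of C2 "Pos a" l] three CF C by metis
    \<comment> \<open>This makes \<open>p\<close> new to \<open>critical a C2\<close>, so that
      \<open>?L2\<close> has four literals.\<close>
    have pq: "p \<noteq> neg q" "p \<noteq> neg l" 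
      using unmixed[OF C(2) C(1), of q] unmixed[OF C(1) C(1), of l] p q by auto
    let ?L2 = "insert p (critical a C2)"
    have "p \<notin> critical a C2" using p pq q by (auto simp: critical_def)
    then have c2: "card ?L2 = 4"
      using critical_props[OF fam C(2)] three CF by simp
    have pV: "atom_of p \<in> V" using supported_familyD(4)[OF fam CF(1)] p by simp
    have 2: "real (card (agreeing \<M> ?L2)) \<le> zeta ^ 4 * rho ^ card V"
      using leaf_weight_0[OF br, of ?L2] critical_props[OF fam C(2)] pV c2 by simp
    have 1: "real (card (agreeing \<M> (critical a C))) \<le> zeta ^ 3 * rho ^ card V" if "C \<in> occ F a" for C
      using leaf_weight_0[OF br critical_props(1-3)[OF fam that]] critical_props(4)[OF fam that] three that
      by (simp add: occ_def)
    define A where "A = agreeing \<M> {Pos a} - agreeing \<M> (critical a C1)"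
    have A: "A \<subseteq> agreeing \<M> ?L2 \<union> agreeing \<M> (critical a C3)"
    proof
      fix M assume M: "M \<in> A"
      then have "M \<in> agreeing \<M> (critical a C2) \<or> M \<in> agreeing \<M> (critical a C3)"
        using critical_cover[OF fam a] C3 by (auto simp: A_def)
      \<comment> \<open>If \<open>C2\<close> is critical, \<open>l\<close> is false; were
        \<open>p\<close> false too, \<open>C1\<close> would be critical.\<close>
      moreover have "sat_literal M p" if "M \<in> agreeing \<M> (critical a C2)"
        using that M p q by (auto simp: A_def agreeing_def critical_def)
      ultimately show "M \<in> agreeing \<M> ?L2 \<union> agreeing \<M> (critical a C3)"
        by (auto simp: agreeing_def)
    qed
    have "card (agreeing \<M> {Pos a}) \<le> card (agreeing \<M> (critical a C1)) + card A"
    proof -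
      have fin: "finite \<M>" using supported_family_finite(2)[OF fam] .
      have "agreeing \<M> {Pos a} \<subseteq> agreeing \<M> (critical a C1) \<union> A" by (auto simp: A_def)
      moreover have "finite (agreeing \<M> (critical a C1) \<union> A)"
        using fin by (simp add: A_def agreeing_def)
      ultimately show ?thesis by (meson card_Un_le card_mono le_trans)
    qed
    then have "real (card (agreeing \<M> {Pos a})) \<le> (2 * zeta ^ 3 + zeta ^ 4) * rho ^ card V"
      using card_le_add_agreeing[OF fam A] 1[of C1] 1[of C3] 2 C3 by (simp add: algebra_simps)
    then show ?thesis
      using two_branches[OF fam split_atom n] branching_weights(5) k3 by simp
  qed
qed

text \<open>Linear as for hypergraphs, but only for clauses with a common positive literal.
  Comparing atoms rules out shared and complementary literals at once.\<close>

definition linear_occurrences :: "'a literal set set \<Rightarrow> bool" where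
  "linear_occurrences F \<longleftrightarrow> (\<forall>a. \<forall>C\<in>occ F a. \<forall>C'\<in>occ F a. \<forall>l\<in>C. \<forall>l'\<in>C'.
     atom_of l = atom_of l' \<and> atom_of l \<noteq> a \<longrightarrow> C = C')"

lemma linear_occurrencesD:
  "linear_occurrences F \<Longrightarrow> C \<in> F \<Longrightarrow> C' \<in> F \<Longrightarrow> Pos a \<in> C \<Longrightarrow> Pos a \<in> C' \<Longrightarrow> l \<in> C \<Longrightarrow> l' \<in> C' \<Longrightarrow>
   atom_of l = atom_of l' \<Longrightarrow> atom_of l \<noteq> a \<Longrightarrow> C = C'"
  unfolding linear_occurrences_def occ_def by blast

text \<open>With \<open>b\<close> true, \<open>C0\<close> shrinks and a second atom \<open>c\<close>
  of it is branched on. Whatever the sign of \<open>c\<close> in \<open>C0\<close>, making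
  \<open>c\<close> false shortens at least two clauses at \<open>c\<close>.\<close>

lemma case_negative:
  assumes br: "branching_family V F \<M>" and three: "\<forall>C\<in>F. card C = 3"
    and lin: "linear_occurrences F" and ge3: "\<forall>a\<in>V. 3 \<le> card (occ F a)"
    and C0: "C0 \<in> F" "Neg b \<in> C0"
  shows "real (card \<M>) \<le> rho ^ card V"
proof -
  note fam = branching_family_supported[OF br]
  have b: "b \<in> V" using supported_familyD(4)[OF fam C0] by simp
  have bC0: "Pos b \<notin> C0" using supported_familyD(5)[OF fam C0] by simp
  have n: "real (card (agreeing \<M> {Neg b})) \<le> zeta * tau ^ 3 * rho ^ card V"
    using neg_branch[OF br b, of 3] ge3 b by simp
  show ?thesis
  proof (cases "\<exists>c. Pos c \<in> C0")
    case True
    then obtain c where c: "Pos c \<in> C0" by blast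
    then obtain p where p: "C0 = {Neg b, Pos c, p}" "p \<noteq> Neg b" "p \<noteq> Pos c"
      using card_3_other[of C0 "Neg b" "Pos c"] three C0 by blast
    have ne: "Neg c \<notin> C0" using supported_familyD(5)[OF fam C0(1) c] by simp
    have V: "c \<in> V" "atom_of p \<in> V"
      using supported_familyD(3)[OF fam C0(1)] unfolding p(1) by auto
    let ?L = "{Pos b, Neg c, p}"
    have pne: "p \<noteq> Pos b" "p \<noteq> Neg c" "b \<noteq> c" "atom_of p \<noteq> c" using p ne bC0 by (cases p; auto)+
    \<comment> \<open>By linearity the clauses at \<open>c\<close> other than \<open>C0\<close>
      contain neither \<open>Pos b\<close> nor \<open>p\<close>, so \<open>?L\<close> satisfies none
      of them.\<close>
    have "real (card (agreeing \<M> ?L)) \<le> zeta ^ card ?L * tau ^ 2 * rho ^ card V"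
    proof (rule leaf_weight_common[OF br, where S = "occ F c - {C0}" and l = "Neg c"])
      have "3 \<le> card (occ F c)" "C0 \<in> occ F c" using ge3 V c C0 by (auto simp: occ_def)
      then show "2 \<le> card (occ F c - {C0})" by simp
      fix C assume C: "C \<in> occ F c - {C0}"
      then have CF: "C \<in> F" "Pos c \<in> C" "C \<noteq> C0" by (auto simp: occ_def)
      have "Pos b \<notin> C" using linear_occurrencesD[OF lin CF(1) C0(1) CF(2) c _ C0(2), of "Pos b"] CF(3) pne by auto
      moreover have "p \<notin> C" using linear_occurrencesD[OF lin CF(1) C0(1) CF(2) c, of p p] p CF(3) pne by auto
      moreover have "Neg c \<notin> C" using supported_familyD(5)[OF fam CF(1,2)] by simp
      ultimately show "C \<inter> ?L = {}" by blast
    qed (use V b in \<open>auto simp: occ_def\<close>)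
    moreover have "card ?L = 3" using pne by simp
    ultimately have 1: "real (card (agreeing \<M> ?L)) \<le> zeta ^ 3 * tau ^ 2 * rho ^ card V" by simp
    have 2: "real (card (agreeing \<M> {Pos b, Pos c})) \<le> zeta ^ 2 * rho ^ card V"
      using leaf_weight_0[OF br, of "{Pos b, Pos c}"] V b pne by (simp add: numeral_2_eq_2)
    have cover: "agreeing \<M> {Pos b} \<subseteq> agreeing \<M> {Pos b, Pos c} \<union> agreeing \<M> ?L"
      using supported_familyD(6)[OF fam _ C0(1)] p by (auto simp: agreeing_def)
    have "real (card (agreeing \<M> {Pos b})) \<le> (zeta ^ 2 + zeta ^ 3 * tau ^ 2) * rho ^ card V"
      using card_le_add_agreeing[OF fam cover] 1 2 by (simp add: algebra_simps)
    then show ?thesis using two_branches[OF fam split_atom n] branching_weights(7) by simp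
  next
    case False
    have "card (C0 - {Neg b}) = 2" using C0 three by simp
    then obtain l where l: "l \<in> C0" "l \<noteq> Neg b" by (metis DiffE card_2_iff insertI1)
    then obtain c where c: "Neg c \<in> C0" "c \<noteq> b" using False by (cases l) auto
    then obtain p where p: "C0 = {Neg b, Neg c, p}" "p \<noteq> Neg b" "p \<noteq> Neg c"
      using card_3_other[of C0 "Neg b" "Neg c"] three C0 by blast
    have pne: "p \<noteq> Pos b" "p \<noteq> Pos c" using False p by auto
    have V: "c \<in> V" "atom_of p \<in> V"
      using supported_familyD(3)[OF fam C0(1)] unfolding p(1) by auto
    \<comment> \<open>Here \<open>C0\<close> is not a clause at \<open>c\<close>. Still, by
      linearity at most one clause at \<open>c\<close> contains \<open>Pos b\<close>, so two of the
      three or more survive.\<close>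
    define S where "S = {C \<in> occ F c. Pos b \<notin> C}"
    have "card (occ F c - S) \<le> Suc 0"
    proof (subst card_le_Suc0_iff_eq)
      show "\<forall>C\<in>occ F c - S. \<forall>C'\<in>occ F c - S. C = C'"
        using linear_occurrencesD[OF lin, of _ _ c "Pos b" "Pos b"] c(2) by (auto simp: S_def occ_def)
    qed (simp add: finite_occ[OF fam])
    moreover have "card (occ F c - S) = card (occ F c) - card S"
      by (rule card_Diff_subset) (auto simp: S_def finite_occ[OF fam])
    ultimately have S: "2 \<le> card S" using ge3 V by fastforce
    have "real (card (agreeing \<M> {Pos b, Neg c})) \<le> zeta ^ card {Pos b, Neg c} * tau ^ 2 * rho ^ card V"
    proof (rule leaf_weight_common[OF br, where S = S and l = "Neg c"])
      show "C \<inter> {Pos b, Neg c} = {}" if "C \<in> S" for C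
        using that supported_familyD(5)[OF fam, of C "Pos c"] by (auto simp: S_def occ_def)
    qed (use V b S in \<open>auto simp: occ_def S_def\<close>)
    then have 1: "real (card (agreeing \<M> {Pos b, Neg c})) \<le> zeta ^ 2 * tau ^ 2 * rho ^ card V"
      by (simp add: numeral_2_eq_2)
    have 2: "real (card (agreeing \<M> {Pos b, Pos c, p})) \<le> zeta ^ 3 * rho ^ card V"
      using leaf_weight_0[OF br, of "{Pos b, Pos c, p}"] V b pne c(2) by (simp add: numeral_3_eq_3)
    have cover: "agreeing \<M> {Pos b} \<subseteq> agreeing \<M> {Pos b, Neg c} \<union> agreeing \<M> {Pos b, Pos c, p}"
      using supported_familyD(6)[OF fam _ C0(1)] p by (auto simp: agreeing_def)
    have "real (card (agreeing \<M> {Pos b})) \<le> (zeta ^ 2 * tau ^ 2 + zeta ^ 3) * rho ^ card V"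
      using card_le_add_agreeing[OF fam cover] 1 2 by (simp add: algebra_simps)
    then show ?thesis using two_branches[OF fam split_atom n] branching_weights(6) by simp
  qed
qed

text \<open>Since \<open>a\<close> has the fewest occurrences, each of the two atoms made false by a
  critical clause lies in at least \<open>card (occ F a) - 1\<close> further clauses. The separate
  \<open>k\<close> allows for the cap 5.\<close>

lemma case_positive:
  assumes br: "branching_family V F \<M>" and three: "\<forall>C\<in>F. card C = 3"
    and lin: "linear_occurrences F" and ge: "\<forall>b\<in>V. card (occ F a) \<le> card (occ F b)" and a: "a \<in> V"
    and pos: "\<And>C b. C \<in> F \<Longrightarrow> Neg b \<notin> C"
    and k: "k \<le> 2 * (card (occ F a) - 1)" "k \<le> 5" "card (occ F a) \<le> 5"
    and w: "zeta * tau ^ card (occ F a) + card (occ F a) * (zeta ^ 3 * tau ^ k) \<le> 1"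
  shows "real (card \<M>) \<le> rho ^ card V"
proof -
  note fam = branching_family_supported[OF br]
  have "real (card (agreeing \<M> {Pos a})) \<le> card (occ F a) * (zeta ^ 3 * tau ^ k * rho ^ card V)"
  proof (rule pos_branch_sum[OF fam a])
    fix C assume C: "C \<in> occ F a"
    then have CF: "C \<in> F" "Pos a \<in> C" by (auto simp: occ_def)
    have "card (C - {Pos a}) = 2" using CF three by simp
    then obtain l m where lm: "C - {Pos a} = {l, m}" "l \<noteq> m" by (meson card_2_iff)
    obtain b where b: "l = Pos b" using pos[OF CF(1)] lm by (cases l) auto
    obtain c where c: "m = Pos c" using pos[OF CF(1)] lm by (cases m) auto
    have Ceq: "C = {Pos a, Pos b, Pos c}" using lm b c CF by blast
    have ne: "b \<noteq> c" "a \<noteq> b" "a \<noteq> c" using lm b c by auto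
    have V: "b \<in> V" "c \<in> V" using supported_familyD(3)[OF fam CF(1)] unfolding Ceq by auto
    let ?L = "critical a C"
    have L: "?L = {Pos a, Neg b, Neg c}" using lm b c by (simp add: critical_def)
    then have negL: "neg ` ?L = {Neg a, Pos b, Pos c}" by simp
    define S where "S = (occ F b - {C}) \<union> (occ F c - {C})"
    \<comment> \<open>A clause with two atoms of \<open>C\<close> is \<open>C\<close> itself. Hence
      the two parts of \<open>S\<close> are disjoint and their clauses avoid
      \<open>Pos a\<close>.\<close>
    have uniq: "C' = C" if "C' \<in> F" "Pos x \<in> C'" "Pos y \<in> C'" "x \<noteq> y" "x \<in> {a, b, c}" "y \<in> {a, b, c}" for C' x y
      using linear_occurrencesD[OF lin that(1) CF(1) that(2), of "Pos y" "Pos y"] that Ceq by auto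
    have "card S = card (occ F b - {C}) + card (occ F c - {C})"
      unfolding S_def using uniq[of _ b c] ne finite_occ[OF fam]
      by (intro card_Un_disjoint) (auto simp: occ_def)
    moreover have "card (occ F b - {C}) = card (occ F b) - 1" "card (occ F c - {C}) = card (occ F c) - 1"
      using Ceq CF by (auto simp: occ_def intro!: card_Diff_singleton)
    ultimately have "card S = (card (occ F b) - 1) + (card (occ F c) - 1)" by simp
    then have kS: "k \<le> card S" using k(1) ge V diff_le_mono[of "card (occ F a)" _ 1] by fastforce
    have SF: "C' \<in> F" "C' \<noteq> C" if "C' \<in> S" for C' using that by (auto simp: S_def occ_def)
    have res: "card (C' - neg ` ?L) = 2" if C': "C' \<in> S" for C'
    proof -
      have "C' - neg ` ?L = C' - {Pos b} \<and> Pos b \<in> C' \<or> C' - neg ` ?L = C' - {Pos c} \<and> Pos c \<in> C'"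
        using C' SF[OF C'] uniq[of C' b c] ne pos[of C'] unfolding negL by (auto simp: S_def occ_def)
      then show ?thesis using three SF(1)[OF C'] by auto
    qed
    have "real (card (agreeing \<M> ?L)) \<le> zeta ^ card ?L * tau ^ k * rho ^ card V"
    proof (rule leaf_weight[OF br critical_props(1-3)[OF fam C], where S = S])
      show "inj_on (\<lambda>C. C - neg ` ?L) S"
      proof (rule inj_onI)
        fix C' C'' assume C': "C' \<in> S" "C'' \<in> S" and eq: "C' - neg ` ?L = C'' - neg ` ?L"
        obtain x y where xy: "C' - neg ` ?L = {x, y}" "x \<noteq> y" using res[OF C'(1)] by (meson card_2_iff)
        have in1: "x \<in> C'" "y \<in> C'" using xy by blast+
        have in2: "x \<in> C''" "y \<in> C''" using xy eq by blast+
        obtain u where u: "x = Pos u" using pos[OF SF(1)[OF C'(1)]] in1 by (cases x) auto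
        obtain v where v: "y = Pos v" using pos[OF SF(1)[OF C'(1)]] in1 by (cases y) auto
        \<comment> \<open>Both clauses contain the distinct atoms \<open>u\<close> and
          \<open>v\<close> positively, which linearity permits only for equal clauses.\<close>
        show "C' = C''"
          using linear_occurrencesD[OF lin SF(1)[OF C'(1)] SF(1)[OF C'(2)], of u y y] in1 in2 u v xy by auto
      qed
      show "C' \<inter> ?L = {}" if C': "C' \<in> S" for C'
        using C' SF[OF C'] uniq[of C' a b] uniq[of C' a c] ne pos[of C'] unfolding L
        by (auto simp: S_def occ_def)
      show "card (C' - neg ` ?L) \<le> 2" if "C' \<in> S" for C' using res[OF that] by simp
    qed (use kS k(2) SF in auto)
    then show "real (card (agreeing \<M> (critical a C))) \<le> zeta ^ 3 * tau ^ k * rho ^ card V"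
      using critical_props(4)[OF fam C] three CF by simp
  qed
  then have p: "real (card (agreeing \<M> {Pos a})) \<le> (card (occ F a) * (zeta ^ 3 * tau ^ k)) * rho ^ card V"
    by (simp add: mult_ac)
  show ?thesis
    by (rule two_branches[OF fam split_atom neg_branch[OF br a le_refl k(3)] p w])
qed

section \<open>Combination of the cases and induction on the number of atoms\<close>

lemma branching_family_bound:
  assumes br: "branching_family V F \<M>" and ne: "V \<noteq> {}"
  shows "real (card \<M>) \<le> rho ^ card V"
proof (cases "\<exists>C\<in>F. card C \<le> 2")
  case True
  then show ?thesis using case_small_clause[OF br] by blast
next
  case False
  note fam = branching_family_supported[OF br]
  have three: "\<forall>C\<in>F. card C = 3"
    using False supported_familyD(2)[OF fam] by (metis le_antisym not_less_eq_eq numeral_2_eq_2 numeral_3_eq_3)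
  show ?thesis
  proof (cases "\<exists>a\<in>V. card (occ F a) \<le> 2 \<or> 5 \<le> card (occ F a)")
    case True
    then show ?thesis using case_few_occurrences[OF br three] case_many_occurrences[OF br] by blast
  next
    case False
    have occ34: "card (occ F a) = 3 \<or> card (occ F a) = 4" if "a \<in> V" for a
    proof -
      have "\<not> card (occ F a) \<le> 2" "\<not> 5 \<le> card (occ F a)" using False that by blast+
      then show ?thesis by linarith
    qed
    show ?thesis
    proof (cases "\<exists>a. \<exists>C1\<in>occ F a. \<exists>C2\<in>occ F a. \<exists>l\<in>C1. neg l \<in> C2")
      case True
      then show ?thesis using case_mixed[OF br three] by blast
    next
      case unmixed: False
      show ?thesis
      proof (cases "linear_occurrences F")
        case False
        then obtain a C1 C2 l l' where C: "C1 \<in> occ F a" "C2 \<in> occ F a" "l \<in> C1" "l' \<in> C2"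
            "atom_of l = atom_of l'" "atom_of l \<noteq> a" "C1 \<noteq> C2"
          unfolding linear_occurrences_def by blast
        \<comment> \<open>The alternative \<open>l = neg l'\<close> would be a complementary pair at
          \<open>a\<close>.\<close>
        have "l' = l" using C(3-5) unmixed C(1,2) by (metis atom_of_eq_iff)
        moreover have "a \<in> V" using C(1) supported_familyD(4)[OF fam, of C1 "Pos a"] by (simp add: occ_def)
        ultimately show ?thesis
          using case_shared[OF br three _ C(1,2,3) _ C(7) _ occ34] unmixed C(4,6) by fastforce
      next
        case lin: True
        show ?thesis
        proof (cases "\<exists>C\<in>F. \<exists>b. Neg b \<in> C")
          case True
          moreover have "\<forall>a\<in>V. 3 \<le> card (occ F a)" using occ34 by fastforce
          ultimately show ?thesis using case_negative[OF br three lin] by blast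
        next
          case False
          then have pos: "Neg b \<notin> C" if "C \<in> F" for C b using that by blast
          show ?thesis
          proof (cases "\<exists>a\<in>V. card (occ F a) = 3")
            case True
            then obtain a where a: "a \<in> V" "card (occ F a) = 3" by blast
            have "\<forall>b\<in>V. card (occ F a) \<le> card (occ F b)" using occ34 a(2) by fastforce
            then show ?thesis
              using case_positive[OF br three lin _ a(1) pos, of 4] a(2) branching_weights(8) by simp
          next
            case False
            obtain a where a: "a \<in> V" using ne by blast
            \<comment> \<open>All occurrence numbers are equal, so any atom is minimal. Of the
              \<open>2 * (4 - 1) = 6\<close> short clauses only 5 can be counted.\<close>
            have four: "\<forall>b\<in>V. card (occ F b) = 4" using occ34 False by blast
            then show ?thesis
              using case_positive[OF br three lin _ a pos, of 5] a branching_weights(9) by simp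
          qed
        qed
      qed
    qed
  qed
qed

theorem supported_family_bound:
  fixes V :: "'a set"
  assumes "supported_family V F \<M>"
  shows "real (card \<M>) \<le> rho ^ card V"
  using assms
proof (induction "card V" arbitrary: V F \<M> rule: less_induct)
  case less
  note fam = less.prems
  show ?case
  proof (cases "V = {}")
    case True
    \<comment> \<open>With no atom left, injectivity allows at most one member.\<close>
    then have "inj_on (\<lambda>M. {}::'a set) \<M>" using fam by (simp add: supported_family_def)
    then have "card \<M> = card ((\<lambda>M. {}::'a set) ` \<M>)" by (simp add: card_image)
    also have "\<dots> \<le> card {{}::'a set}" by (rule card_mono) auto
    finally show ?thesis using True by simp
  next
    case False
    \<comment> \<open>Fixing a nonempty \<open>L\<close> removes an atom, so the induction
      hypothesis covers every family up to the remaining size.\<close>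
    have "bounded_family (V - atom_of ` L) (residual F L) (agreeing \<M> L)"
      if L: "L \<noteq> {}" "atom_of ` L \<subseteq> V" for L
    proof -
      have "card (V - atom_of ` L) < card V"
        using L supported_family_finite(1)[OF fam] by (intro psubset_card_mono) auto
      then show ?thesis
        unfolding bounded_family_def
        using supported_family_residual[OF fam] less.hyps le_less_trans by blast
    qed
    then have "branching_family V F \<M>" using fam by (simp add: branching_family_def)
    then show ?thesis using branching_family_bound False by blast
  qed
qed

section \<open>Stable models\<close>

fun clause_literals :: "'a clause \<Rightarrow> 'a literal set" where
  "clause_literals (Rule p B) = insert (Pos p) (neg ` B)"
| "clause_literals (Constraint B) = neg ` B"

lemma sat_clause_literals: "sat_clause M c \<longleftrightarrow> (\<exists>l\<in>clause_literals c. sat_literal M l)"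
  by (cases c) auto

lemma atom_of_clause_literals: "atom_of ` clause_literals c = clause_atoms c"
  by (cases c) (auto simp: image_image)

text \<open>The inequality can be strict: if \<open>Neg p\<close> is in the body of a rule with head
  \<open>p\<close>, the head coincides with a flipped body literal.\<close>

lemma card_clause_literals:
  assumes "finite (body c)"
  shows "finite (clause_literals c)" "card (clause_literals c) \<le> num_literals c"
proof -
  have "card (neg ` B) = card B" for B :: "'a literal set" by (simp add: card_image inj_on_def)
  then show "card (clause_literals c) \<le> num_literals c"
    using assms by (cases c) (auto simp: card_insert_if)
  show "finite (clause_literals c)" using assms by (cases c) auto
qed

text \<open>A rule whose body holds in \<open>M\<close> survives in the reduct, and there its
  positive part forces the head.\<close>

lemma stable_model_sat:
  assumes M: "stable_model P M" and c: "c \<in> P"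
  shows "sat_clause M c"
proof (cases c)
  case (Constraint B)
  then show ?thesis using M c by (simp add: stable_model_def)
next
  case (Rule p B)
  show ?thesis
  proof (cases "\<exists>l\<in>B. \<not> sat_literal M l")
    case True
    then show ?thesis using Rule by auto
  next
    case False
    then have "\<forall>a\<in>M. Neg a \<notin> B" by (metis sat_literal.simps(2))
    then have "Rule p {l \<in> B. \<exists>a. l = Pos a} \<in> reduct P M"
      using Rule c by (auto simp: reduct_def)
    then have "sat_clause M (Rule p {l \<in> B. \<exists>a. l = Pos a})"
      using M unfolding stable_model_def least_model_def model_def by blast
    then show ?thesis using Rule False by simp
  qed
qed

text \<open>Removing \<open>a\<close> from a stable model must violate some rule of the reduct; that rule has head
  \<open>a\<close> and a body that holds without \<open>a\<close>.\<close>

lemma stable_model_critical: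
  assumes M: "stable_model P M" and a: "a \<in> M"
  obtains B where "Rule a B \<in> P" "Pos a \<notin> B" "\<forall>l\<in>B. sat_literal M l"
proof -
  have lm: "model (reduct P M) M" "\<And>N. model (reduct P M) N \<Longrightarrow> M \<subseteq> N"
    using M by (auto simp: stable_model_def least_model_def)
  have "\<not> model (reduct P M) (M - {a})" using lm(2) a by blast
  then obtain c where c: "c \<in> reduct P M" "\<not> sat_clause (M - {a}) c" by (auto simp: model_def)
  then obtain p B where B: "c = Rule p {l \<in> B. \<exists>a. l = Pos a}" "Rule p B \<in> P" "\<forall>a\<in>M. Neg a \<notin> B"
    by (auto simp: reduct_def)
  have body: "x \<in> M \<and> x \<noteq> a" if "Pos x \<in> B" for x using c(2) B(1) that by auto
  have "sat_clause M c" using lm(1) c(1) by (simp add: model_def)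
  then have "p = a" using c(2) B(1) body by auto
  moreover have "sat_literal M l" if "l \<in> B" for l
    using that body B(3) by (cases l) auto
  ultimately show thesis using that B(2) body by blast
qed

text \<open>The branching relies on clauses without complementary literals, so tautologies are
  discarded. The clause from \<open>stable_model_critical\<close> is not among them: besides
  \<open>Pos a\<close> all its literals are false in \<open>M\<close>, and it lacks
  \<open>Neg a\<close>.\<close>

lemma stable_models_supported:
  assumes P: "t_program 3 P"
  shows "supported_family (At P) {C \<in> clause_literals ` P. \<forall>l\<in>C. neg l \<notin> C} {M. stable_model P M}"
    (is "supported_family _ ?F _")
  unfolding supported_family_def
proof (intro conjI ballI)
  show "finite (At P)" using P finite_At by (auto simp: t_program_def)
  show "inj_on (\<lambda>M. M \<inter> At P) {M. stable_model P M}"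
    by (rule inj_onI) (auto simp: stable_model_def)
next
  fix C assume "C \<in> ?F"
  then obtain c where c: "c \<in> P" "C = clause_literals c" and nt: "\<forall>l\<in>C. neg l \<notin> C" by blast
  have fin: "finite (body c)" "num_literals c \<le> 3"
    using P c(1) by (auto simp: t_program_def logic_program_def)
  show "finite C" "card C \<le> 3" using card_clause_literals[OF fin(1)] fin(2) c(2) by auto
  show "atom_of ` C \<subseteq> At P" using c by (auto simp: atom_of_clause_literals At_def)
  show "neg l \<notin> C" if "l \<in> C" for l using nt that by blast
next
  fix M C assume "M \<in> {M. stable_model P M}" "C \<in> ?F"
  then show "\<exists>l\<in>C. sat_literal M l"
    using stable_model_sat sat_clause_literals by fastforce
next
  fix M a assume "M \<in> {M. stable_model P M}" "a \<in> M \<inter> At P"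
  then have "stable_model P M" "a \<in> M" by simp_all
  then obtain B where B: "Rule a B \<in> P" "Pos a \<notin> B" "\<forall>l\<in>B. sat_literal M l"
    by (rule stable_model_critical)
  define C where "C = clause_literals (Rule a B)"
  have others: "\<forall>l\<in>C - {Pos a}. \<not> sat_literal M l" using B(3) by (auto simp: C_def)
  have "Neg a \<notin> neg ` B" using B(2) by (metis imageE neg.simps(2) neg_neg)
  then have "Neg a \<notin> C" by (simp add: C_def)
  have "neg l \<notin> C" if l: "l \<in> C" for l
  proof
    assume "neg l \<in> C"
    \<comment> \<open>One literal of a complementary pair is true in \<open>M\<close>, so a pair
      over another atom would contradict \<open>others\<close>.\<close>
    moreover have "l = Pos a \<or> l = Neg a"
    proof (rule ccontr)
      assume "\<not> ?thesis"
      then have "l \<in> C - {Pos a}" "neg l \<in> C - {Pos a}"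
        using l \<open>neg l \<in> C\<close> by (cases l; simp)+
      then show False using others sat_literal_neg[of M l] by blast
    qed
    ultimately show False using \<open>Neg a \<notin> C\<close> l by auto
  qed
  moreover have "C \<in> clause_literals ` P" using B(1) unfolding C_def by (rule imageI)
  ultimately have "C \<in> ?F" by blast
  moreover have "Pos a \<in> C" by (simp add: C_def)
  ultimately show "\<exists>C\<in>?F. Pos a \<in> C \<and> (\<forall>l\<in>C - {Pos a}. \<not> sat_literal M l)"
    using others by blast
qed

theorem theorem10:
  "\<exists>C::real. \<forall>n. \<forall>P::'a program.
     t_program 3 P \<and> card (At P) = n \<longrightarrow>
       real (card {M. stable_model P M}) \<le> C * 1.70711 ^ n"
\<comment> \<open>The constant 1 works: branching weights never sum to more than 1, and a family
  without atoms has at most one member.\<close>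
proof (rule exI[of _ 1], intro allI impI)
  fix n and P :: "'a program"
  assume "t_program 3 P \<and> card (At P) = n"
  then show "real (card {M. stable_model P M}) \<le> 1 * 1.70711 ^ n"
    using supported_family_bound[OF stable_models_supported, of P] by (auto simp: rho_def)
qed

end
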